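(* Let $A\in\mathbb{R}^{n\times n}$ be a nonsingular $M$-matrix, let $m$ be an integer with $1\le m<n$, write $A=T_m-E_m-F_m$ for its band decomposition, and let $H_{GJ}=T_m^{-1}(E_m+F_m)$. Let $\omega$ be a real number with $0<\omega<\dfrac{2}{1+\rho(H_{GJ})}$. If $\rho(T_m^{-1}E_m)<\dfrac{1}{\omega}$, then the generalized SOR (GSOR) method with parameters $m$ and $\omega$ for the system $Ax=b$ converges for any initial guess $x^{(0)}$.
   Context: A real matrix $A\in\mathbb{R}^{n\times n}$ is an $M$-matrix if $A=sI-B$ with $B\ge 0$ entrywise and $s\ge\rho(B)$, where $\rho$ denotes the spectral radius. For an $n\times n$ matrix $A=(a_{ij})$ and an integer $1\le m<n$, the band decomposition is $A=T_m-E_m-F_m$, where $T_m$ has entries $a_{ij}$ if $|i-j|\le m$ and $0$ otherwise; $E_m$ has entries $-a_{ij}$ if $i>j+m$ and $0$ otherwise; $F_m$ has entries $-a_{ij}$ if $j>i+m$ and $0$ otherwise. When $A$ is a nonsingular $M$-matrix, so is $T_m$, so $T_m^{-1}$ exists. $H_{GJ}$ is the iteration matrix of the generalized Jacobi method. The GSOR method with parameters $m$ and $\omega$ is the iteration $$x^{(k+1)}=(T_m-\omega E_m)^{-1}\left[(1-\omega)T_m+\omega F_m\right]x^{(k)}+\omega(T_m-\omega E_m)^{-1}b,\qquad k\ge 0.$$ "The method converges" means that $T_m-\omega E_m$ is invertible (so the iteration is defined) and that for every $b$ and every initial guess $x^{(0)}$ the sequence $x^{(k)}$ converges to the solution of $Ax=b$;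 equivalently, $T_m-\omega E_m$ is invertible and $\rho\big((T_m-\omega E_m)^{-1}[(1-\omega)T_m+\omega F_m]\big)<1$. *)

theory Defs
  imports
    "Jordan_Normal_Form.Gauss_Jordan_Elimination"
    "Jordan_Normal_Form.Spectral_Radius"
begin

definition real_spectral_radius :: "real mat \<Rightarrow> real" where
  "real_spectral_radius A = spectral_radius (map_mat complex_of_real A)"

definition M_matrix :: "real mat \<Rightarrow> bool" where
  "M_matrix A \<longleftrightarrow> square_mat A \<and>
    (\<exists>s B. B \<in> carrier_mat (dim_row A) (dim_row A) \<and>
      (\<forall>i < dim_row A. \<forall>j < dim_row A. 0 \<le> B $$ (i, j)) \<and>
      real_spectral_radius B \<le> s \<and>
      A = s \<cdot>\<^sub>m 1\<^sub>m (dim_row A) - B)"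

text \<open>The value is unspecified when the matrix is not invertible.\<close>

definition mat_inv :: "'a :: field mat \<Rightarrow> 'a mat" where
  "mat_inv A = the (mat_inverse A)"

lemma mat_inv:
  assumes A: "A \<in> carrier_mat n n" and inv: "invertible_mat A"
  shows "mat_inv A \<in> carrier_mat n n" "A * mat_inv A = 1\<^sub>m n" "mat_inv A * A = 1\<^sub>m n"
proof -
  obtain B where AB: "A * B = 1\<^sub>m n" and BA: "B * A = 1\<^sub>m (dim_row B)"
    using inv A unfolding invertible_mat_def inverts_mat_def by auto
  have "dim_col B = n" using arg_cong[OF AB, of dim_col] by simp
  moreover have "dim_row B = n" using arg_cong[OF BA, of dim_col] A by simp
  ultimately have B: "B \<in> carrier_mat n n" by auto
  have "A \<in> Units (ring_mat TYPE('a) n ())"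
    using A B AB BA unfolding Units_def ring_mat_def by auto
  then obtain C where "mat_inverse A = Some C"
    using mat_inverse(1)[OF A, where b = "()"] by (cases "mat_inverse A") auto
  with mat_inverse(2)[OF A this]
  show "mat_inv A \<in> carrier_mat n n" "A * mat_inv A = 1\<^sub>m n" "mat_inv A * A = 1\<^sub>m n"
    by (auto simp: mat_inv_def)
qed

definition band_T :: "nat \<Rightarrow> real mat \<Rightarrow> real mat" where
  "band_T m A = mat (dim_row A) (dim_col A)
    (\<lambda>(i, j). if \<bar>int i - int j\<bar> \<le> int m then A $$ (i, j) else 0)"

definition band_E :: "nat \<Rightarrow> real mat \<Rightarrow> real mat" where
  "band_E m A = mat (dim_row A) (dim_col A)
    (\<lambda>(i, j). if i > j + m then - A $$ (i, j) else 0)"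

definition band_F :: "nat \<Rightarrow> real mat \<Rightarrow> real mat" where
  "band_F m A = mat (dim_row A) (dim_col A)
    (\<lambda>(i, j). if j > i + m then - A $$ (i, j) else 0)"

lemma band_decomposition: "A = band_T m A - band_E m A - band_F m A"
  by (rule eq_matI) (auto simp: band_T_def band_E_def band_F_def)

definition GJ_matrix :: "nat \<Rightarrow> real mat \<Rightarrow> real mat" where
  "GJ_matrix m A = mat_inv (band_T m A) * (band_E m A + band_F m A)"

fun GSOR_iterate ::
  "nat \<Rightarrow> real \<Rightarrow> real mat \<Rightarrow> real vec \<Rightarrow> real vec \<Rightarrow> nat \<Rightarrow> real vec" where
  "GSOR_iterate m \<omega> A b x0 0 = x0"
| "GSOR_iterate m \<omega> A b x0 (Suc k) =
     (mat_inv (band_T m A - \<omega> \<cdot>\<^sub>m band_E m A)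
        * ((1 - \<omega>) \<cdot>\<^sub>m band_T m A + \<omega> \<cdot>\<^sub>m band_F m A)) *\<^sub>v GSOR_iterate m \<omega> A b x0 k
     + \<omega> \<cdot>\<^sub>v (mat_inv (band_T m A - \<omega> \<cdot>\<^sub>m band_E m A) *\<^sub>v b)"

text \<open>The solution \<open>x\<close> of the system is required to exist and be unique; vectors
  converge componentwise.\<close>

definition GSOR_converges :: "nat \<Rightarrow> real \<Rightarrow> real mat \<Rightarrow> bool" where
  "GSOR_converges m \<omega> A \<longleftrightarrow>
    invertible_mat (band_T m A - \<omega> \<cdot>\<^sub>m band_E m A) \<and>
    (\<forall>b \<in> carrier_vec (dim_row A). \<forall>x0 \<in> carrier_vec (dim_col A).
      \<exists>x. {y \<in> carrier_vec (dim_col A). A *\<^sub>v y = b} = {x} \<and>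
        (\<forall>i < dim_col A. (\<lambda>k. GSOR_iterate m \<omega> A b x0 k $ i) \<longlonglongrightarrow> x $ i))"

end

(* Write L = T^-1 E and U = T^-1 F, which are nonnegative, so H_GJ = L + U. The condition on omega
yields a positive vector w with |1 - omega| w + omega H_GJ w < w: for omega <= 1 take w with A w > 0,
for omega > 1 a truncated Neumann series for (2 - omega)/omega > rho(H_GJ). An error step satisfies
e' = omega L e' + ((1 - omega) I + omega U) e, and evaluating this at an index maximising |e'_i| / w_i
shows that the step contracts the weighted maximum norm given by w. *)

theory Submission
  imports Defs
begin

section \<open>Matrices and positive vectors\<close>

text \<open>H_GJ may be reducible, so a Perron eigenvector can vanish at some index and cannot serve
  as a weight. A strict inequality H_GJ w < t w with t > rho(H_GJ) always has a positive solution
  and does the same work. The range of omega decides where w comes from. For omega > 1 the bound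
  omega < 2/(1 + rho) reads rho < (2 - omega)/omega, exactly what |1 - omega| + omega rho < 1
  demands. For omega < 1 that demand is rho < 1, which the bound on omega does not give. It has to
  come from A, through T^-1 A w = w - H_GJ w. Since an M-matrix may have s = rho(B), nonsingularity
  must supply the w with A w > 0. The new error is kept on both sides of its equation, so the
  estimate never inverts T - omega E. Applied to a zero old error, it therefore also proves that T -
  omega E is invertible.\<close>

lemma index_mult_mat_vec_sum:
  assumes "A \<in> carrier_mat n n" "v \<in> carrier_vec n" "i < n"
  shows "(A *\<^sub>v v) $ i = (\<Sum>j<n. A $$ (i, j) * v $ j)"
  using assms by (auto simp: scalar_prod_def lessThan_atLeast0)

lemma smult_mat_mult_vec:
  fixes A :: "'a :: comm_ring_1 mat"
  assumes "A \<in> carrier_mat n n" "v \<in> carrier_vec n"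
  shows "(k \<cdot>\<^sub>m A) *\<^sub>v v = k \<cdot>\<^sub>v (A *\<^sub>v v)"
  using assms by (intro eq_vecI) (auto simp: scalar_prod_def sum_distrib_left mult.assoc)

lemma mult_mat_vec_nonneg:
  fixes A :: "real mat"
  assumes "A \<in> carrier_mat n n" "v \<in> carrier_vec n" "i < n"
    and "\<And>j. j < n \<Longrightarrow> 0 \<le> A $$ (i, j)" "\<And>j. j < n \<Longrightarrow> 0 \<le> v $ j"
  shows "0 \<le> (A *\<^sub>v v) $ i"
  using assms unfolding index_mult_mat_vec_sum[OF assms(1-3)] by (auto intro!: sum_nonneg)

lemma invertible_mat_if_trivial_kernel:
  fixes A :: "'a :: field mat"
  assumes A: "A \<in> carrier_mat n n"
    and ker: "\<And>v. v \<in> carrier_vec n \<Longrightarrow> A *\<^sub>v v = 0\<^sub>v n \<Longrightarrow> v = 0\<^sub>v n"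
  shows "invertible_mat A"
proof -
  have "det A \<noteq> 0"
    using det_0_iff_vec_prod_zero[OF A] ker by blast
  from det_non_zero_imp_unit[OF A this, of "()"] A show ?thesis
    unfolding invertible_mat_def inverts_mat_def Units_def ring_mat_def by auto
qed

text \<open>Off the diagonal every term of the row is nonpositive. The lemma is applied at indices
  where \<open>v\<close> vanishes, where it makes the row value nonpositive.\<close>

lemma Z_matrix_mult_vec_le:
  fixes A :: "real mat"
  assumes A: "A \<in> carrier_mat n n"
    and off: "\<And>j. j < n \<Longrightarrow> i \<noteq> j \<Longrightarrow> A $$ (i, j) \<le> 0"
    and v: "v \<in> carrier_vec n" "\<And>j. j < n \<Longrightarrow> 0 \<le> v $ j"
    and i: "i < n"
  shows "(A *\<^sub>v v) $ i \<le> A $$ (i, i) * v $ i"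
proof -
  have "(A *\<^sub>v v) $ i = A $$ (i, i) * v $ i + (\<Sum>j\<in>{..<n} - {i}. A $$ (i, j) * v $ j)"
    using i by (simp add: index_mult_mat_vec_sum[OF A v(1) i] sum.remove)
  also have "(\<Sum>j\<in>{..<n} - {i}. A $$ (i, j) * v $ j) \<le> 0"
    using off v by (intro sum_nonpos mult_nonpos_nonneg) auto
  finally show ?thesis by simp
qed

text \<open>A zero of \<open>v\<close> at \<open>i\<close> would leave only nonpositive terms in
  that row. This upgrades nonnegative vectors to admissible weights.\<close>

lemma Z_matrix_vec_pos:
  fixes A :: "real mat"
  assumes A: "A \<in> carrier_mat n n"
    and off: "\<And>i j. i < n \<Longrightarrow> j < n \<Longrightarrow> i \<noteq> j \<Longrightarrow> A $$ (i, j) \<le> 0"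
    and v: "v \<in> carrier_vec n" "\<And>j. j < n \<Longrightarrow> 0 \<le> v $ j"
    and i: "i < n" and pos: "0 < (A *\<^sub>v v) $ i"
  shows "0 < v $ i"
proof (rule ccontr)
  assume "\<not> 0 < v $ i"
  then have "v $ i = 0"
    using v(2)[OF i] by simp
  then show False
    using Z_matrix_mult_vec_le[OF A off[OF i] v i] pos by simp
qed

text \<open>At an index minimising \<open>v\<^sub>i / w\<^sub>i\<close>, a negative minimum \<open>r\<close> would give
  \<open>(A v)\<^sub>i \<le> r (A w)\<^sub>i < 0\<close>.\<close>

lemma Z_matrix_inverse_nonneg:
  fixes A :: "real mat"
  assumes A: "A \<in> carrier_mat n n"
    and off: "\<And>i j. i < n \<Longrightarrow> j < n \<Longrightarrow> i \<noteq> j \<Longrightarrow> A $$ (i, j) \<le> 0"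
    and w: "w \<in> carrier_vec n" "\<And>i. i < n \<Longrightarrow> 0 < w $ i"
    and Aw: "\<And>i. i < n \<Longrightarrow> 0 < (A *\<^sub>v w) $ i"
    and v: "v \<in> carrier_vec n" and Av: "\<And>i. i < n \<Longrightarrow> 0 \<le> (A *\<^sub>v v) $ i"
    and k: "k < n"
  shows "0 \<le> v $ k"
proof (rule ccontr)
  assume neg: "\<not> 0 \<le> v $ k"
  define q where "q i = v $ i / w $ i" for i
  obtain i where i: "i < n" and min: "\<And>j. j < n \<Longrightarrow> q i \<le> q j"
    using arg_min_if_finite[of "{..<n}" q] k by (metis finite_lessThan lessThan_iff
        empty_iff linorder_not_less)
  have "q k < 0"
    using neg w(2)[OF k] by (simp add: q_def divide_neg_pos)
  then have qi: "q i < 0"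
    using min[OF k] by simp
  \<comment> \<open>Removing the minimal multiple of \<open>w\<close> leaves a nonnegative vector
    that vanishes at \<open>i\<close>.\<close>
  define u where "u = v - q i \<cdot>\<^sub>v w"
  have u: "u \<in> carrier_vec n"
    using v w by (simp add: u_def)
  have u_ge: "0 \<le> u $ j" if "j < n" for j
    using min[OF that] w(1) w(2)[OF that] v that by (simp add: u_def q_def[of j] pos_le_divide_eq)
  have "u $ i = 0"
    using v w(1) w(2)[OF i] i by (simp add: u_def q_def)
  then have "(A *\<^sub>v u) $ i \<le> 0"
    using Z_matrix_mult_vec_le[OF A off[OF i] u u_ge i] by simp
  moreover have "A *\<^sub>v u = A *\<^sub>v v - q i \<cdot>\<^sub>v (A *\<^sub>v w)"
    using A v w by (simp add: u_def mult_minus_distrib_mat_vec[OF A] mult_mat_vec[OF A])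
  then have "(A *\<^sub>v u) $ i = (A *\<^sub>v v) $ i - q i * (A *\<^sub>v w) $ i"
    using A v w i by (simp del: index_mult_mat_vec)
  ultimately show False
    using Av[OF i] mult_neg_pos[OF qi Aw[OF i]] by simp
qed

text \<open>For a kernel vector \<open>v\<close>, monotonicity applies to both \<open>v\<close> and
  \<open>-v\<close>.\<close>

lemma Z_matrix_invertible:
  fixes A :: "real mat"
  assumes A: "A \<in> carrier_mat n n"
    and off: "\<And>i j. i < n \<Longrightarrow> j < n \<Longrightarrow> i \<noteq> j \<Longrightarrow> A $$ (i, j) \<le> 0"
    and w: "w \<in> carrier_vec n" "\<And>i. i < n \<Longrightarrow> 0 < w $ i"
    and Aw: "\<And>i. i < n \<Longrightarrow> 0 < (A *\<^sub>v w) $ i"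
  shows "invertible_mat A"
proof (rule invertible_mat_if_trivial_kernel[OF A])
  fix v :: "real vec"
  assume v: "v \<in> carrier_vec n" and ker: "A *\<^sub>v v = 0\<^sub>v n"
  note nonneg = Z_matrix_inverse_nonneg[OF A off w Aw]
  have "A *\<^sub>v (- 1 \<cdot>\<^sub>v v) = 0\<^sub>v n"
    by (subst mult_mat_vec[OF A v]) (auto simp: ker)
  then have "0 \<le> (- 1 \<cdot>\<^sub>v v) $ k" if "k < n" for k
    using nonneg[of "- 1 \<cdot>\<^sub>v v" k] v that by (auto simp del: index_mult_mat_vec)
  moreover have "0 \<le> v $ k" if "k < n" for k
    using nonneg[of v k] v ker that by (auto simp del: index_mult_mat_vec)
  ultimately show "v = 0\<^sub>v n"
    using v by (intro eq_vecI) (auto intro: antisym)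
qed

section \<open>Spectral radius and positive test vectors\<close>

lemma real_spectral_radius_nonneg:
  assumes "B \<in> carrier_mat n n" "0 < n"
  shows "0 \<le> real_spectral_radius B"
proof -
  have "real_spectral_radius B \<in> norm ` spectrum (map_mat complex_of_real B)"
    unfolding real_spectral_radius_def by (rule spectral_radius_mem_max(1)) (use assms in auto)
  then show ?thesis by auto
qed

text \<open>An eigenvector of B/t for the eigenvalue l is one of B for t l, hence t |l| <= rho(B) <
  t. The scaling to radius below 1 makes the bound on matrix powers applicable.\<close>

lemma real_spectral_radius_smult_less:
  assumes B: "B \<in> carrier_mat n n" and n: "0 < n"
    and less: "real_spectral_radius B < t"
  shows "real_spectral_radius ((1 / t) \<cdot>\<^sub>m B) < 1"
proof -
  let ?B = "map_mat complex_of_real B"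
  let ?D = "map_mat complex_of_real ((1 / t) \<cdot>\<^sub>m B)"
  have cB: "?B \<in> carrier_mat n n" and cD: "?D \<in> carrier_mat n n"
    using B by auto
  have t: "0 < t"
    using less real_spectral_radius_nonneg[OF B n] by linarith
  obtain l where l: "l \<in> spectrum ?D" "spectral_radius ?D = norm l"
    using spectral_radius_mem_max(1)[OF cD n] by auto
  obtain v where v: "v \<in> carrier_vec n" "v \<noteq> 0\<^sub>v n" "?D *\<^sub>v v = l \<cdot>\<^sub>v v"
    using l(1) cD by (auto simp: spectrum_def eigenvalue_def eigenvector_def)
  have B_eq: "?B = of_real t \<cdot>\<^sub>m ?D"
    using t B by (intro eq_matI) auto
  have "?B *\<^sub>v v = of_real t \<cdot>\<^sub>v (?D *\<^sub>v v)"
    unfolding B_eq by (rule smult_mat_mult_vec[OF cD v(1)])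
  then have "?B *\<^sub>v v = (of_real t * l) \<cdot>\<^sub>v v"
    by (simp add: v(3) smult_smult_assoc)
  then have "of_real t * l \<in> spectrum ?B"
    using v B by (auto simp: spectrum_def eigenvalue_def eigenvector_def)
  then have "norm (of_real t * l) \<le> spectral_radius ?B"
    using spectral_radius_mem_max(2)[OF cB n] by blast
  then have "t * norm l \<le> spectral_radius ?B"
    using t by (simp add: norm_mult)
  then have "t * norm l < t * 1"
    using less unfolding real_spectral_radius_def by linarith
  then have "norm l < 1"
    using t mult_less_cancel_left_pos by blast
  then show ?thesis
    using l(2) by (simp add: real_spectral_radius_def)
qed

text \<open>The matrix power appends its new factor on the right, while the terms of the Neumann
  series arise by applying the matrix on the left.\<close>

lemma mult_pow_mat_commute:
  assumes "A \<in> carrier_mat n n"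
  shows "A * A ^\<^sub>m k = A ^\<^sub>m k * A"
proof (induction k)
  case (Suc k)
  have "A * A ^\<^sub>m Suc k = (A * A ^\<^sub>m k) * A"
    using assms by (simp add: assoc_mult_mat[OF assms pow_carrier_mat[OF assms] assms])
  then show ?case by (simp add: Suc)
qed (use assms in auto)

lemma pow_mat_nonneg:
  fixes A :: "real mat"
  assumes A: "A \<in> carrier_mat n n"
    and nonneg: "\<And>i j. i < n \<Longrightarrow> j < n \<Longrightarrow> 0 \<le> A $$ (i, j)"
    and "i < n" "j < n"
  shows "0 \<le> (A ^\<^sub>m k) $$ (i, j)"
  using assms(3,4)
proof (induction k arbitrary: i j)
  case (Suc k)
  then show ?case
    using A nonneg pow_carrier_mat[OF A, of k]
    by (auto simp: scalar_prod_def intro!: sum_nonneg)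
qed (use A in auto)

text \<open>The vector is the truncated Neumann series \<open>\<Sum>k<N. (D/\<tau>)\<^sup>k 1\<close>, for which
  \<open>\<tau> w - D w = \<tau> (1 - (D/\<tau>)\<^sup>N 1)\<close>; the powers of \<open>D\<close> are bounded, so \<open>(D/\<tau>)\<^sup>N 1 < 1\<close> for large \<open>N\<close>.\<close>

lemma spectral_radius_less_1_test_vec:
  assumes D: "D \<in> carrier_mat n n" and nonneg: "\<And>i j. i < n \<Longrightarrow> j < n \<Longrightarrow> 0 \<le> D $$ (i, j)"
    and less: "real_spectral_radius D < 1" and tau: "1 < \<tau>"
  obtains w where "w \<in> carrier_vec n" "\<And>i. i < n \<Longrightarrow> 0 < w $ i"
    "\<And>i. i < n \<Longrightarrow> (D *\<^sub>v w) $ i < \<tau> * w $ i"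
proof -
  let ?D = "map_mat complex_of_real D"
  have cD: "?D \<in> carrier_mat n n"
    using D by auto
  obtain b where b: "\<And>k. norm_bound (?D ^\<^sub>m k) b"
    using spectral_radius_jnf_norm_bound_less_1_upper_triangular[OF cD] less
    unfolding real_spectral_radius_def by blast
  have pow: "D ^\<^sub>m k \<in> carrier_mat n n" for k
    using D by simp
  have bound: "(D ^\<^sub>m k) $$ (i, j) \<le> b" if "i < n" "j < n" for i j k
  proof -
    have "?D ^\<^sub>m k = map_mat complex_of_real (D ^\<^sub>m k)"
      by (rule of_real_hom.mat_hom_pow[OF D, symmetric])
    then have "norm (complex_of_real ((D ^\<^sub>m k) $$ (i, j))) \<le> b"
      using b[of k] that pow[of k] D unfolding norm_bound_def by auto
    then show ?thesis by simp
  qed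
  define x where "x k = D ^\<^sub>m k *\<^sub>v vec n (\<lambda>_. 1)" for k
  have x: "x k \<in> carrier_vec n" for k
    using pow[of k] by (auto simp: x_def)
  have x_sum: "x k $ i = (\<Sum>j<n. (D ^\<^sub>m k) $$ (i, j))" if "i < n" for i k
    using index_mult_mat_vec_sum[OF pow, of "vec n (\<lambda>_. 1)" i k] that by (simp add: x_def)
  have x0: "x 0 $ i = 1" if "i < n" for i
    using that D by (simp add: x_sum)
  have x_Suc: "D *\<^sub>v x k = x (Suc k)" for k
    using assoc_mult_mat_vec[OF D pow[of k], of "vec n (\<lambda>_. 1)"]
    by (simp add: x_def mult_pow_mat_commute[OF D])
  have x_ge: "0 \<le> x k $ i" if "i < n" for i k
    using that pow_mat_nonneg[OF D nonneg] by (auto simp: x_sum intro!: sum_nonneg)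
  have x_le: "x k $ i \<le> n * b" if "i < n" for i k
    using sum_bounded_above[of "{..<n}" "\<lambda>j. (D ^\<^sub>m k) $$ (i, j)" b] bound that by (simp add: x_sum)
  \<comment> \<open>Since \<open>n * b\<close> bounds the entries of \<open>x N\<close>, the last
    term drops below 1. The 1 in the maximum forces \<open>0 < N\<close>, so the series contains its
    initial term 1 and \<open>w\<close> is positive.\<close>
  obtain N where N: "max 1 (n * b) < \<tau> ^ N"
    using real_arch_pow[OF tau] by blast
  have "0 < N"
    using N by (cases N) auto
  define w where "w = vec n (\<lambda>i. \<Sum>k<N. x k $ i / \<tau> ^ k)"
  show ?thesis
  proof
    show w: "w \<in> carrier_vec n"
      by (simp add: w_def)
    fix i assume i: "i < n"
    have "x 0 $ i / \<tau> ^ 0 \<le> (\<Sum>k<N. x k $ i / \<tau> ^ k)"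
      using \<open>0 < N\<close> x_ge[OF i] tau by (intro member_le_sum) auto
    then show "0 < w $ i"
      using i by (simp add: w_def x0)
    have "(D *\<^sub>v w) $ i = (\<Sum>j<n. \<Sum>k<N. D $$ (i, j) * x k $ j / \<tau> ^ k)"
      unfolding index_mult_mat_vec_sum[OF D w i] by (simp add: w_def sum_distrib_left)
    also have "\<dots> = (\<Sum>k<N. (D *\<^sub>v x k) $ i / \<tau> ^ k)"
      unfolding index_mult_mat_vec_sum[OF D x i] sum_divide_distrib by (rule sum.swap)
    also have "\<dots> = \<tau> * (\<Sum>k<N. x (Suc k) $ i / \<tau> ^ Suc k)"
      using tau by (simp add: x_Suc sum_distrib_left del: index_mult_mat_vec)
    \<comment> \<open>The shifted series gains the term of index \<open>N\<close> and loses the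
      initial term 1.\<close>
    also have "(\<Sum>k<N. x (Suc k) $ i / \<tau> ^ Suc k) = w $ i + (x N $ i / \<tau> ^ N - 1)"
      using sum.lessThan_Suc_shift[of "\<lambda>k. x k $ i / \<tau> ^ k" N] i
      by (simp add: w_def x0)
    also have "x N $ i / \<tau> ^ N < 1"
      using x_le[OF i, of N] N tau by (simp add: divide_less_eq)
    finally show "(D *\<^sub>v w) $ i < \<tau> * w $ i"
      using tau by simp
  qed
qed

text \<open>An intermediate s splits the gap between rho(B) and t: B/s has radius below 1, so its
  powers are bounded, and the remaining factor t/s > 1 outgrows that bound.\<close>

lemma spectral_radius_less_test_vec:
  assumes B: "B \<in> carrier_mat n n" and nonneg: "\<And>i j. i < n \<Longrightarrow> j < n \<Longrightarrow> 0 \<le> B $$ (i, j)"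
    and n: "0 < n" and less: "real_spectral_radius B < t"
  obtains w where "w \<in> carrier_vec n" "\<And>i. i < n \<Longrightarrow> 0 < w $ i"
    "\<And>i. i < n \<Longrightarrow> (B *\<^sub>v w) $ i < t * w $ i"
proof -
  obtain s where s: "real_spectral_radius B < s" "s < t"
    using dense[OF less] by blast
  have s0: "0 < s"
    using s(1) real_spectral_radius_nonneg[OF B n] by linarith
  define D where "D = (1 / s) \<cdot>\<^sub>m B"
  have D: "D \<in> carrier_mat n n"
    using B by (simp add: D_def)
  have D_nonneg: "0 \<le> D $$ (i, j)" if "i < n" "j < n" for i j
    using nonneg[OF that] s0 B that by (simp add: D_def)
  have "real_spectral_radius D < 1"
    unfolding D_def by (rule real_spectral_radius_smult_less[OF B n s(1)])
  moreover have "1 < t / s"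
    using s s0 by simp
  ultimately obtain w where w: "w \<in> carrier_vec n" "\<And>i. i < n \<Longrightarrow> 0 < w $ i"
    "\<And>i. i < n \<Longrightarrow> (D *\<^sub>v w) $ i < t / s * w $ i"
    using spectral_radius_less_1_test_vec[OF D D_nonneg] by metis
  have "(B *\<^sub>v w) $ i = s * (D *\<^sub>v w) $ i" if "i < n" for i
    using that s0 B by (simp add: index_mult_mat_vec_sum[OF _ w(1)] D_def sum_distrib_left
        index_mult_mat_vec_sum[OF B w(1)] index_mult_mat_vec_sum[OF D[unfolded D_def] w(1)] del: index_mult_mat_vec)
  then have "(B *\<^sub>v w) $ i < t * w $ i" if "i < n" for i
    using w(3)[OF that] that s0 by (simp add: field_simps del: index_mult_mat_vec)
  with w that show ?thesis by blast
qed

lemma index_smult_one_minus_mult_vec: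
  fixes B :: "'a :: comm_ring_1 mat"
  assumes "B \<in> carrier_mat n n" "v \<in> carrier_vec n" "i < n"
  shows "((s \<cdot>\<^sub>m 1\<^sub>m n - B) *\<^sub>v v) $ i = s * v $ i - (B *\<^sub>v v) $ i"
proof -
  have "(s \<cdot>\<^sub>m 1\<^sub>m n - B) *\<^sub>v v = (s \<cdot>\<^sub>m 1\<^sub>m n) *\<^sub>v v - B *\<^sub>v v"
    by (rule minus_mult_distrib_mat_vec) (use assms in auto)
  also have "(s \<cdot>\<^sub>m 1\<^sub>m n) *\<^sub>v v = s \<cdot>\<^sub>v v"
    using smult_mat_mult_vec[OF one_carrier_mat assms(2)] assms(2) by simp
  finally show ?thesis
    using assms by (simp del: index_mult_mat_vec)
qed

lemma M_matrix_off_diagonal: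
  assumes "M_matrix A" "A \<in> carrier_mat n n" "i < n" "j < n" "i \<noteq> j"
  shows "A $$ (i, j) \<le> 0"
proof -
  obtain s B where B: "B \<in> carrier_mat n n" "\<forall>i<n. \<forall>j<n. 0 \<le> B $$ (i, j)"
    and A: "A = s \<cdot>\<^sub>m 1\<^sub>m n - B"
    using assms(1,2) unfolding M_matrix_def by auto
  then show ?thesis
    using assms(3-5) by simp
qed

text \<open>The vector is \<open>A\<^sup>-\<^sup>1 1\<close>: its image under \<open>A + \<epsilon> I\<close> is still nonnegative for small
  \<open>\<epsilon> > 0\<close>, and \<open>A + \<epsilon> I\<close> is covered by the strict inequality \<open>\<rho>(B) < s + \<epsilon>\<close>.\<close>

lemma M_matrix_test_vec:
  assumes A: "A \<in> carrier_mat n n" and n: "0 < n" and M: "M_matrix A" and inv: "invertible_mat A"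
  obtains w where "w \<in> carrier_vec n" "\<And>i. i < n \<Longrightarrow> 0 < w $ i"
    "\<And>i. i < n \<Longrightarrow> 0 < (A *\<^sub>v w) $ i"
proof -
  obtain s B where B: "B \<in> carrier_mat n n" "\<And>i j. i < n \<Longrightarrow> j < n \<Longrightarrow> 0 \<le> B $$ (i, j)"
    and s: "real_spectral_radius B \<le> s" and A_eq: "A = s \<cdot>\<^sub>m 1\<^sub>m n - B"
    using M A unfolding M_matrix_def by auto
  define u where "u = mat_inv A *\<^sub>v vec n (\<lambda>_. 1)"
  have u: "u \<in> carrier_vec n"
    using mat_inv(1)[OF A inv] by (auto simp: u_def)
  have Au: "A *\<^sub>v u = vec n (\<lambda>_. 1)"
    unfolding u_def using mat_inv(1,2)[OF A inv] A
    by (subst assoc_mult_mat_vec[symmetric, of _ n n _ n]) auto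
  \<comment> \<open>Small enough that (A + epsilon I) u = 1 + epsilon u stays nonnegative whatever
    the signs in \<open>u\<close>.\<close>
  define \<epsilon> where "\<epsilon> = 1 / (1 + (\<Sum>j<n. \<bar>u $ j\<bar>))"
  have S: "0 < 1 + (\<Sum>j<n. \<bar>u $ j\<bar>)"
    by (smt (verit) sum_nonneg abs_ge_zero)
  then have eps: "0 < \<epsilon>"
    by (simp add: \<epsilon>_def)
  have eps_u: "- 1 \<le> \<epsilon> * u $ i" if "i < n" for i
  proof -
    have "\<bar>u $ i\<bar> \<le> (\<Sum>j<n. \<bar>u $ j\<bar>)"
      using that by (intro member_le_sum) auto
    then have "- u $ i \<le> 1 + (\<Sum>j<n. \<bar>u $ j\<bar>)"
      by linarith
    then show ?thesis
      using S by (simp add: \<epsilon>_def field_simps)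
  qed
  define C where "C = (s + \<epsilon>) \<cdot>\<^sub>m 1\<^sub>m n - B"
  have C: "C \<in> carrier_mat n n"
    using B by (simp add: C_def minus_carrier_mat)
  have C_vec: "(C *\<^sub>v v) $ i = (s + \<epsilon>) * v $ i - (B *\<^sub>v v) $ i"
    if "v \<in> carrier_vec n" "i < n" for v i
    unfolding C_def by (rule index_smult_one_minus_mult_vec[OF B(1) that])
  have C_off: "C $$ (i, j) \<le> 0" if "i < n" "j < n" "i \<noteq> j" for i j
    using B that by (simp add: C_def)
  have "real_spectral_radius B < s + \<epsilon>"
    using s eps by linarith
  from spectral_radius_less_test_vec[OF B n this]
  obtain w where w: "w \<in> carrier_vec n" "\<And>i. i < n \<Longrightarrow> 0 < w $ i"
    "\<And>i. i < n \<Longrightarrow> (B *\<^sub>v w) $ i < (s + \<epsilon>) * w $ i"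
    by blast
  have "(C *\<^sub>v u) $ i = (A *\<^sub>v u) $ i + \<epsilon> * u $ i" if "i < n" for i
    unfolding C_vec[OF u that] A_eq index_smult_one_minus_mult_vec[OF B(1) u that]
    by (simp add: algebra_simps del: index_mult_mat_vec)
  then have "0 \<le> (C *\<^sub>v u) $ i" if "i < n" for i
    using eps_u[OF that] that by (simp add: Au del: index_mult_mat_vec)
  \<comment> \<open>The vector \<open>w\<close> only certifies that \<open>C\<close> is monotone;
    the conclusion is drawn for \<open>u\<close>, the vector with a positive image under
    \<open>A\<close> itself.\<close>
  then have u_ge: "0 \<le> u $ i" if "i < n" for i
    using Z_matrix_inverse_nonneg[OF C C_off w(1,2) _ u _ that] C_vec[OF w(1)] w(3)
    by (simp del: index_mult_mat_vec)
  have pos: "0 < (A *\<^sub>v u) $ i" if "i < n" for i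
    unfolding Au using that by simp
  have "0 < u $ i" if "i < n" for i
    using Z_matrix_vec_pos[OF A M_matrix_off_diagonal[OF M A] u u_ge that pos[OF that]] .
  with u pos that show ?thesis by blast
qed

section \<open>Convergence of the iteration\<close>

lemma ex_max_index:
  fixes q :: "nat \<Rightarrow> real"
  assumes "0 < n"
  obtains p where "p < n" "\<And>j. j < n \<Longrightarrow> q j \<le> q p"
proof -
  have "Max (q ` {..<n}) \<in> q ` {..<n}"
    using assms by (intro Max_in) auto
  then obtain p where "p < n" "q p = Max (q ` {..<n})" by auto
  with that show ?thesis by simp
qed

text \<open>As \<open>y\<close> also occurs on the right, its weighted norm d is not known to be at
  most c. Bounding both vectors by M = max c d gives d <= theta M at the maximising index; d > c
  would mean d <= theta d with d > 0, which theta < 1 excludes. Hence M = c.\<close>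

lemma implicit_step_contraction:
  fixes L N :: "nat \<Rightarrow> nat \<Rightarrow> real" and w x y :: "nat \<Rightarrow> real"
  assumes w: "\<And>i. i < n \<Longrightarrow> 0 < w i"
    and row: "\<And>i. i < n \<Longrightarrow> (\<Sum>j<n. (\<bar>L i j\<bar> + \<bar>N i j\<bar>) * w j) \<le> \<theta> * w i" and "\<theta> < 1"
    and y: "\<And>i. i < n \<Longrightarrow> y i = (\<Sum>j<n. L i j * y j) + (\<Sum>j<n. N i j * x j)"
    and x: "\<And>i. i < n \<Longrightarrow> \<bar>x i\<bar> \<le> c * w i"
    and i: "i < n"
  shows "\<bar>y i\<bar> \<le> \<theta> * c * w i"
proof -
  have "0 < n" using i by simp
  then obtain p where p: "p < n" and max: "\<And>j. j < n \<Longrightarrow> \<bar>y j\<bar> / w j \<le> \<bar>y p\<bar> / w p"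
    using ex_max_index[of n "\<lambda>j. \<bar>y j\<bar> / w j"] by metis
  define d where "d = \<bar>y p\<bar> / w p"
  define M where "M = max c d"
  have y_le: "\<bar>y j\<bar> \<le> d * w j" if "j < n" for j
    using max[OF that] w[OF that] by (simp add: d_def[symmetric] pos_divide_le_eq)
  have "0 \<le> c * w p"
    using x[OF p] by linarith
  then have c: "0 \<le> c"
    using w[OF p] by (simp add: zero_le_mult_iff)
  have M: "0 \<le> M"
    using c by (simp add: M_def)
  have step: "\<bar>y i\<bar> \<le> M * \<theta> * w i" if "i < n" for i
  proof -
    have "\<bar>y i\<bar> = \<bar>\<Sum>j<n. L i j * y j + N i j * x j\<bar>"
      using y[OF that] by (simp add: sum.distrib)
    also have "\<dots> \<le> (\<Sum>j<n. M * ((\<bar>L i j\<bar> + \<bar>N i j\<bar>) * w j))"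
    proof (rule order_trans[OF sum_abs sum_mono])
      fix j assume "j \<in> {..<n}"
      then have j: "j < n" by simp
      have "\<bar>y j\<bar> \<le> M * w j" "\<bar>x j\<bar> \<le> M * w j"
        using y_le[OF j] x[OF j] w[OF j] mult_right_mono[of d M "w j"] mult_right_mono[of c M "w j"]
        unfolding M_def by linarith+
      then have "\<bar>L i j\<bar> * \<bar>y j\<bar> + \<bar>N i j\<bar> * \<bar>x j\<bar> \<le> \<bar>L i j\<bar> * (M * w j) + \<bar>N i j\<bar> * (M * w j)"
        by (intro add_mono mult_left_mono) auto
      moreover have "\<bar>L i j * y j + N i j * x j\<bar> \<le> \<bar>L i j\<bar> * \<bar>y j\<bar> + \<bar>N i j\<bar> * \<bar>x j\<bar>"
        by (metis abs_mult abs_triangle_ineq)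
      ultimately show "\<bar>L i j * y j + N i j * x j\<bar> \<le> M * ((\<bar>L i j\<bar> + \<bar>N i j\<bar>) * w j)"
        by (simp add: algebra_simps)
    qed
    also have "\<dots> \<le> M * (\<theta> * w i)"
      unfolding sum_distrib_left[symmetric] by (rule mult_left_mono[OF row[OF that] M])
    finally show ?thesis by (simp add: mult.assoc)
  qed
  have "d * w p \<le> M * \<theta> * w p"
    using step[OF p] w[OF p] by (simp add: d_def)
  then have d_le: "d \<le> M * \<theta>"
    using w[OF p] by simp
  have "M = c"
  proof (rule ccontr)
    assume "M \<noteq> c"
    then have "M = d" "c < d"
      by (auto simp: M_def max_def split: if_splits)
    then have "d * 1 \<le> d * \<theta>" "0 < d"
      using d_le c by auto
    then show False
      using \<open>\<theta> < 1\<close> by simp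
  qed
  then show ?thesis
    using step[OF i] by (simp add: mult.commute)
qed

text \<open>Multiplying by \<open>Ti\<close> and leaving the \<open>E\<close> term on the side of
  \<open>y\<close> gives the form required by \<open>implicit_step_contraction\<close>, before T -
  omega E is known to be invertible.\<close>

lemma GSOR_step_iteration:
  fixes T E F :: "real mat"
  assumes carr: "Ti \<in> carrier_mat n n" "T \<in> carrier_mat n n" "E \<in> carrier_mat n n" "F \<in> carrier_mat n n"
    and Ti: "Ti * T = 1\<^sub>m n"
    and xy: "x \<in> carrier_vec n" "y \<in> carrier_vec n"
    and step: "(T - \<omega> \<cdot>\<^sub>m E) *\<^sub>v y = ((1 - \<omega>) \<cdot>\<^sub>m T + \<omega> \<cdot>\<^sub>m F) *\<^sub>v x"
    and i: "i < n"
  shows "y $ i = (\<Sum>j<n. (\<omega> * (Ti * E) $$ (i, j)) * y $ j)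
    + (\<Sum>j<n. ((if i = j then 1 - \<omega> else 0) + \<omega> * (Ti * F) $$ (i, j)) * x $ j)"
proof -
  have TE: "Ti * E \<in> carrier_mat n n" and TF: "Ti * F \<in> carrier_mat n n"
    using carr by auto
  have cancel: "Ti *\<^sub>v (T *\<^sub>v v) = v" if "v \<in> carrier_vec n" for v
    using assoc_mult_mat_vec[OF carr(1,2) that] Ti that by simp
  have "(T - \<omega> \<cdot>\<^sub>m E) *\<^sub>v y = T *\<^sub>v y - \<omega> \<cdot>\<^sub>v (E *\<^sub>v y)"
    using carr xy by (subst minus_mult_distrib_mat_vec[of _ n n]) (auto simp: smult_mat_mult_vec)
  then have "Ti *\<^sub>v ((T - \<omega> \<cdot>\<^sub>m E) *\<^sub>v y) = y - \<omega> \<cdot>\<^sub>v ((Ti * E) *\<^sub>v y)"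
    using carr xy by (simp add: mult_minus_distrib_mat_vec[of _ n n] cancel mult_mat_vec[of _ n n])
  then have l: "(Ti *\<^sub>v ((T - \<omega> \<cdot>\<^sub>m E) *\<^sub>v y)) $ i = y $ i - \<omega> * ((Ti * E) *\<^sub>v y) $ i"
    using carr xy i by (simp del: index_mult_mat_vec assoc_mult_mat_vec)
  have "((1 - \<omega>) \<cdot>\<^sub>m T + \<omega> \<cdot>\<^sub>m F) *\<^sub>v x = (1 - \<omega>) \<cdot>\<^sub>v (T *\<^sub>v x) + \<omega> \<cdot>\<^sub>v (F *\<^sub>v x)"
    using carr xy by (subst add_mult_distrib_mat_vec[of _ n n]) (auto simp: smult_mat_mult_vec)
  then have "Ti *\<^sub>v (((1 - \<omega>) \<cdot>\<^sub>m T + \<omega> \<cdot>\<^sub>m F) *\<^sub>v x) = (1 - \<omega>) \<cdot>\<^sub>v x + \<omega> \<cdot>\<^sub>v ((Ti * F) *\<^sub>v x)"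
    using carr xy by (simp add: mult_add_distrib_mat_vec[of _ n n] cancel mult_mat_vec[of _ n n])
  then have r: "(Ti *\<^sub>v (((1 - \<omega>) \<cdot>\<^sub>m T + \<omega> \<cdot>\<^sub>m F) *\<^sub>v x)) $ i
      = (1 - \<omega>) * x $ i + \<omega> * ((Ti * F) *\<^sub>v x) $ i"
    using carr xy i by (simp del: index_mult_mat_vec assoc_mult_mat_vec)
  have delta: "(\<Sum>j<n. (if i = j then 1 - \<omega> else 0) * x $ j) = (1 - \<omega>) * x $ i"
    using i by (simp add: if_distrib[of "\<lambda>z. z * _"] cong: if_cong)
  have "y $ i = \<omega> * ((Ti * E) *\<^sub>v y) $ i + ((1 - \<omega>) * x $ i + \<omega> * ((Ti * F) *\<^sub>v x) $ i)"
    using l r step by simp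
  then show ?thesis
    unfolding index_mult_mat_vec_sum[OF TE xy(2) i] index_mult_mat_vec_sum[OF TF xy(1) i]
    by (simp add: distrib_right sum.distrib delta sum_distrib_left mult.assoc)
qed

theorem theorem3p14:
  fixes A :: "real mat" and n m :: nat and \<omega> :: real
  assumes "A \<in> carrier_mat n n"
    and "M_matrix A"
    and "invertible_mat A"
    and "1 \<le> m" and "m < n"
    and "0 < \<omega>" and "\<omega> < 2 / (1 + real_spectral_radius (GJ_matrix m A))"
    and "real_spectral_radius (mat_inv (band_T m A) * band_E m A) < 1 / \<omega>"
  shows "GSOR_converges m \<omega> A"
proof -
  note A = assms(1) and M = assms(2) and inv = assms(3)
  have n: "0 < n" using \<open>m < n\<close> by simp
  define T where "T = band_T m A"
  define E where "E = band_E m A"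
  define F where "F = band_F m A"
  have T: "T \<in> carrier_mat n n" and E: "E \<in> carrier_mat n n" and F: "F \<in> carrier_mat n n"
    using A by (auto simp: T_def E_def F_def band_T_def band_E_def band_F_def)
  note off = M_matrix_off_diagonal[OF M A]
  have T_off: "T $$ (i, j) \<le> 0" if "i < n" "j < n" "i \<noteq> j" for i j
    using off[OF that] that A by (simp add: T_def band_T_def)
  have E_ge: "0 \<le> E $$ (i, j)" and F_ge: "0 \<le> F $$ (i, j)" if "i < n" "j < n" for i j
    using off[OF that] that A by (auto simp: E_def F_def band_E_def band_F_def)
  have A_vec: "A *\<^sub>v v = T *\<^sub>v v - E *\<^sub>v v - F *\<^sub>v v" if "v \<in> carrier_vec n" for v
    using that T E F minus_mult_distrib_mat_vec[of "T - E" n n F v]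
      minus_mult_distrib_mat_vec[of T n n E v] band_decomposition[of A m]
    by (simp add: T_def E_def F_def minus_carrier_mat)
  have A_vec_index: "(A *\<^sub>v v) $ i = (T *\<^sub>v v) $ i - (E *\<^sub>v v) $ i - (F *\<^sub>v v) $ i"
    if "v \<in> carrier_vec n" "i < n" for v i
    unfolding A_vec[OF that(1)] using T E F that by (simp del: index_mult_mat_vec)

  \<comment> \<open>Inverse of the band part and nonnegativity of the splitting of H_GJ\<close>
  obtain g where g: "g \<in> carrier_vec n" "\<And>i. i < n \<Longrightarrow> 0 < g $ i"
    "\<And>i. i < n \<Longrightarrow> 0 < (A *\<^sub>v g) $ i"
    using M_matrix_test_vec[OF A n M inv] by blast
  \<comment> \<open>T g = A g + E g + F g with \<open>E\<close> and \<open>F\<close> nonnegative, so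
    the certificate for \<open>A\<close> also serves \<open>T\<close>.\<close>
  have Tg: "0 < (T *\<^sub>v g) $ i" if "i < n" for i
  proof -
    have "0 \<le> (E *\<^sub>v g) $ i" "0 \<le> (F *\<^sub>v g) $ i"
      using mult_mat_vec_nonneg[OF E g(1) that] mult_mat_vec_nonneg[OF F g(1) that]
        E_ge F_ge g(2) that by (simp_all add: less_imp_le del: index_mult_mat_vec)
    then show ?thesis
      using g(3)[OF that] A_vec_index[OF g(1) that] by linarith
  qed
  have T_inv: "invertible_mat T"
    by (rule Z_matrix_invertible[OF T T_off g(1,2) Tg])
  define Ti where "Ti = mat_inv T"
  have Ti: "Ti \<in> carrier_mat n n" "T * Ti = 1\<^sub>m n" "Ti * T = 1\<^sub>m n"
    using mat_inv[OF T T_inv] by (simp_all add: Ti_def)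
  have T_Ti: "T *\<^sub>v (Ti *\<^sub>v z) = z" if "z \<in> carrier_vec n" for z
    using assoc_mult_mat_vec[OF T Ti(1) that] Ti(2) that by simp
  have Ti_ge: "0 \<le> (Ti *\<^sub>v z) $ k"
    if "z \<in> carrier_vec n" "\<And>i. i < n \<Longrightarrow> 0 \<le> z $ i" "k < n" for z k
    using Z_matrix_inverse_nonneg[OF T T_off g(1,2) Tg, of "Ti *\<^sub>v z" k] T_Ti Ti(1) that
    by (simp del: index_mult_mat_vec assoc_mult_mat_vec)
  \<comment> \<open>Each column of the product is \<open>Ti\<close> applied to a column of
    \<open>B\<close>.\<close>
  have Ti_mult_ge: "0 \<le> (Ti * B) $$ (i, j)"
    if "B \<in> carrier_mat n n" "\<And>i j. i < n \<Longrightarrow> j < n \<Longrightarrow> 0 \<le> B $$ (i, j)" "i < n" "j < n" for B i j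
    using Ti_ge[of "col B j" i] that Ti(1) by simp
  define L where "L = Ti * E"
  define U where "U = Ti * F"
  define H where "H = GJ_matrix m A"
  have L: "L \<in> carrier_mat n n" and U: "U \<in> carrier_mat n n"
    using Ti E F by (auto simp: L_def U_def)
  have L_ge: "0 \<le> L $$ (i, j)" and U_ge: "0 \<le> U $$ (i, j)" if "i < n" "j < n" for i j
    using Ti_mult_ge[OF E E_ge that] Ti_mult_ge[OF F F_ge that] by (simp_all add: L_def U_def)
  have H_eq: "H = L + U"
    using Ti(1) E F by (simp add: H_def GJ_matrix_def L_def U_def T_def E_def F_def Ti_def
        mult_add_distrib_mat[of _ n n])
  have H: "H \<in> carrier_mat n n"
    using L U by (simp add: H_eq)
  have H_ge: "0 \<le> H $$ (i, j)" if "i < n" "j < n" for i j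
    using L_ge[OF that] U_ge[OF that] L U that by (simp add: H_eq)

  \<comment> \<open>The positive weight\<close>
  obtain w where w: "w \<in> carrier_vec n" "\<And>i. i < n \<Longrightarrow> 0 < w $ i"
    and contr: "\<And>i. i < n \<Longrightarrow> \<bar>1 - \<omega>\<bar> * w $ i + \<omega> * (H *\<^sub>v w) $ i < w $ i"
  proof (cases "\<omega> \<le> 1")
    case True
    have "Ti *\<^sub>v (A *\<^sub>v g) = g - H *\<^sub>v g"
    proof -
      have "A *\<^sub>v g = T *\<^sub>v g - (E + F) *\<^sub>v g"
        unfolding A_vec[OF g(1)] add_mult_distrib_mat_vec[OF E F g(1)]
        using T E F g(1) by (intro eq_vecI) (simp_all del: index_mult_mat_vec)
      then have "Ti *\<^sub>v (A *\<^sub>v g) = (Ti * T) *\<^sub>v g - (Ti * (E + F)) *\<^sub>v g"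
        using mult_minus_distrib_mat_vec[OF Ti(1), of "T *\<^sub>v g" "(E + F) *\<^sub>v g"]
          assoc_mult_mat_vec[OF Ti(1) T g(1)] assoc_mult_mat_vec[OF Ti(1) add_carrier_mat[OF F] g(1)]
          T mult_mat_vec_carrier[OF add_carrier_mat[OF F] g(1)] g(1) by simp
      then show ?thesis
        using Ti g(1) by (simp add: H_def GJ_matrix_def T_def E_def F_def Ti_def)
    qed
    \<comment> \<open>\<open>Ti_ge\<close> alone gives only a nonnegative vector; strictness follows
      because \<open>T\<close> maps it to A g > 0.\<close>
    moreover have "0 < (Ti *\<^sub>v (A *\<^sub>v g)) $ i" if "i < n" for i
    proof (rule Z_matrix_vec_pos[OF T T_off _ _ that])
      show "Ti *\<^sub>v (A *\<^sub>v g) \<in> carrier_vec n"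
        using Ti(1) A g(1) by (intro mult_mat_vec_carrier)
      show "0 \<le> (Ti *\<^sub>v (A *\<^sub>v g)) $ j" if "j < n" for j
        using Ti_ge[of "A *\<^sub>v g"] A g that by (simp add: less_imp_le del: index_mult_mat_vec)
      show "0 < (T *\<^sub>v (Ti *\<^sub>v (A *\<^sub>v g))) $ i"
        using T_Ti[of "A *\<^sub>v g"] A g that by (simp del: index_mult_mat_vec assoc_mult_mat_vec)
    qed
    ultimately have less: "(H *\<^sub>v g) $ i < g $ i" if "i < n" for i
      using that H g(1) by (simp del: index_mult_mat_vec)
    have "\<bar>1 - \<omega>\<bar> * g $ i + \<omega> * (H *\<^sub>v g) $ i < g $ i" if "i < n" for i
      using mult_strict_left_mono[OF less[OF that] \<open>0 < \<omega>\<close>] True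
      by (simp add: algebra_simps del: index_mult_mat_vec)
    with g that show ?thesis by blast
  next
    case False
    \<comment> \<open>Here |1 - omega| = omega - 1, so the target is omega H h < (2 - omega)
      h.\<close>
    have "0 < 1 + real_spectral_radius H"
      using real_spectral_radius_nonneg[OF H n] by simp
    then have "real_spectral_radius H < (2 - \<omega>) / \<omega>"
      using assms(6,7) by (simp add: H_def field_simps)
    then obtain h where h: "h \<in> carrier_vec n" "\<And>i. i < n \<Longrightarrow> 0 < h $ i"
      "\<And>i. i < n \<Longrightarrow> (H *\<^sub>v h) $ i < (2 - \<omega>) / \<omega> * h $ i"
      using spectral_radius_less_test_vec[OF H H_ge n] by blast
    have "\<bar>1 - \<omega>\<bar> * h $ i + \<omega> * (H *\<^sub>v h) $ i < h $ i" if "i < n" for i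
    proof -
      have "\<omega> * (H *\<^sub>v h) $ i < (2 - \<omega>) * h $ i"
        using mult_strict_left_mono[OF h(3)[OF that] \<open>0 < \<omega>\<close>] \<open>0 < \<omega>\<close>
        by (simp del: index_mult_mat_vec)
      then show ?thesis
        using False by (simp add: algebra_simps del: index_mult_mat_vec)
    qed
    with h that show ?thesis by blast
  qed

  \<comment> \<open>The contraction factor\<close>
  define r where "r i = (\<bar>1 - \<omega>\<bar> * w $ i + \<omega> * (H *\<^sub>v w) $ i) / w $ i" for i
  obtain p where p: "p < n" and r_max: "\<And>i. i < n \<Longrightarrow> r i \<le> r p"
    using ex_max_index[OF n, of r] by blast
  \<comment> \<open>There are finitely many rows, so the strict rowwise inequalities have a common
    factor below 1.\<close>
  define \<theta> where "\<theta> = r p"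
  have theta: "0 \<le> \<theta>" "\<theta> < 1"
    using mult_mat_vec_nonneg[OF H w(1) p] H_ge[OF p] w(2) contr[OF p] \<open>0 < \<omega>\<close> w(2)[OF p]
    by (simp_all add: \<theta>_def r_def less_imp_le del: index_mult_mat_vec)
  define L' where "L' i j = \<omega> * L $$ (i, j)" for i j
  define N where "N i j = (if i = j then 1 - \<omega> else 0) + \<omega> * U $$ (i, j)" for i j
  have row: "(\<Sum>j<n. (\<bar>L' i j\<bar> + \<bar>N i j\<bar>) * w $ j) \<le> \<theta> * w $ i" if i: "i < n" for i
  proof -
    have "(\<Sum>j<n. (\<bar>L' i j\<bar> + \<bar>N i j\<bar>) * w $ j)
        \<le> (\<Sum>j<n. (if i = j then \<bar>1 - \<omega>\<bar> * w $ i else 0) + \<omega> * (H $$ (i, j) * w $ j))"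
    proof (rule sum_mono)
      fix j assume "j \<in> {..<n}"
      then have j: "j < n" by simp
      \<comment> \<open>Only an inequality: for omega > 1 the diagonal entry adds terms of opposite
        sign.\<close>
      have "\<bar>N i j\<bar> \<le> (if i = j then \<bar>1 - \<omega>\<bar> else 0) + \<omega> * U $$ (i, j)"
        using U_ge[OF i j] \<open>0 < \<omega>\<close> abs_triangle_ineq[of "1 - \<omega>" "\<omega> * U $$ (i, j)"]
        by (cases "i = j") (simp_all add: N_def)
      moreover have "\<bar>L' i j\<bar> = \<omega> * L $$ (i, j)"
        using L_ge[OF i j] \<open>0 < \<omega>\<close> by (simp add: L'_def)
      ultimately have "\<bar>L' i j\<bar> + \<bar>N i j\<bar> \<le> (if i = j then \<bar>1 - \<omega>\<bar> else 0) + \<omega> * H $$ (i, j)"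
        using L U i j by (simp add: H_eq distrib_left)
      from mult_right_mono[OF this less_imp_le[OF w(2)[OF j]]]
      show "(\<bar>L' i j\<bar> + \<bar>N i j\<bar>) * w $ j
          \<le> (if i = j then \<bar>1 - \<omega>\<bar> * w $ i else 0) + \<omega> * (H $$ (i, j) * w $ j)"
        by (auto simp: distrib_right mult.assoc split: if_splits)
    qed
    also have "\<dots> = \<bar>1 - \<omega>\<bar> * w $ i + \<omega> * (H *\<^sub>v w) $ i"
      unfolding index_mult_mat_vec_sum[OF H w(1) i] using i
      by (simp add: sum.distrib sum_distrib_left)
    also have "\<dots> = r i * w $ i"
      using w(2)[OF i] by (simp add: r_def del: index_mult_mat_vec)
    also have "\<dots> \<le> \<theta> * w $ i"
      using r_max[OF i] w(2)[OF i] by (simp add: \<theta>_def)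
    finally show ?thesis .
  qed

  \<comment> \<open>Invertibility of T - omega E and decay of the error\<close>
  define P where "P = T - \<omega> \<cdot>\<^sub>m E"
  define Q where "Q = (1 - \<omega>) \<cdot>\<^sub>m T + \<omega> \<cdot>\<^sub>m F"
  have P: "P \<in> carrier_mat n n" and Q: "Q \<in> carrier_mat n n"
    using T E F by (auto simp: P_def Q_def minus_carrier_mat)
  have step: "\<bar>y $ i\<bar> \<le> \<theta> * c * w $ i"
    if xy: "x \<in> carrier_vec n" "y \<in> carrier_vec n" and eq: "P *\<^sub>v y = Q *\<^sub>v x"
      and x: "\<And>i. i < n \<Longrightarrow> \<bar>x $ i\<bar> \<le> c * w $ i" and i: "i < n" for x y c i
  proof (rule implicit_step_contraction[where L = L' and N = N and x = "\<lambda>i. x $ i" and w = "\<lambda>i. w $ i",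
        OF w(2) row theta(2) _ x i])
    show "y $ k = (\<Sum>j<n. L' k j * y $ j) + (\<Sum>j<n. N k j * x $ j)" if "k < n" for k
      unfolding L'_def N_def L_def U_def
      by (rule GSOR_step_iteration[OF Ti(1) T E F Ti(3) xy eq[unfolded P_def Q_def] that])
  qed
  \<comment> \<open>A kernel vector of \<open>P\<close> is the outcome of a step from the zero
    error, for which \<open>c = 0\<close> is a valid bound.\<close>
  have P_inv: "invertible_mat P"
  proof (rule invertible_mat_if_trivial_kernel[OF P])
    fix v assume v: "v \<in> carrier_vec n" and "P *\<^sub>v v = 0\<^sub>v n"
    then have eq: "P *\<^sub>v v = Q *\<^sub>v 0\<^sub>v n"
      using Q by auto
    show "v = 0\<^sub>v n"
      using step[OF zero_carrier_vec v eq, of 0] v by (intro eq_vecI) auto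
  qed
  note Pi = mat_inv[OF P P_inv]
  have "\<exists>x. {y \<in> carrier_vec n. A *\<^sub>v y = b} = {x} \<and>
      (\<forall>i<n. (\<lambda>k. GSOR_iterate m \<omega> A b x0 k $ i) \<longlonglongrightarrow> x $ i)"
    if b: "b \<in> carrier_vec n" and x0: "x0 \<in> carrier_vec n" for b x0
  proof -
    note Ai = mat_inv[OF A inv]
    define x where "x = mat_inv A *\<^sub>v b"
    have x: "x \<in> carrier_vec n"
      using Ai b by (auto simp: x_def)
    have Ax: "A *\<^sub>v x = b"
      using assoc_mult_mat_vec[OF A Ai(1) b] Ai(2) b by (simp add: x_def)
    have "y = x" if "y \<in> carrier_vec n" "A *\<^sub>v y = b" for y
      using assoc_mult_mat_vec[OF Ai(1) A that(1)] Ai(3) that by (simp add: x_def)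
    then have sol: "{y \<in> carrier_vec n. A *\<^sub>v y = b} = {x}"
      using x Ax by blast
    \<comment> \<open>This is P - Q = omega A applied to the solution.\<close>
    have fixpoint: "P *\<^sub>v x = Q *\<^sub>v x + \<omega> \<cdot>\<^sub>v b"
    proof -
      have Px: "P *\<^sub>v x = T *\<^sub>v x - \<omega> \<cdot>\<^sub>v (E *\<^sub>v x)"
        unfolding P_def using T E x
        by (subst minus_mult_distrib_mat_vec[of _ n n]) (auto simp: smult_mat_mult_vec)
      have Qx: "Q *\<^sub>v x = (1 - \<omega>) \<cdot>\<^sub>v (T *\<^sub>v x) + \<omega> \<cdot>\<^sub>v (F *\<^sub>v x)"
        unfolding Q_def using T F x
        by (subst add_mult_distrib_mat_vec[of _ n n]) (auto simp: smult_mat_mult_vec)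
      show ?thesis
        unfolding Px Qx Ax[symmetric] A_vec[OF x] using T E F x
        by (intro eq_vecI) (simp_all add: algebra_simps del: index_mult_mat_vec)
    qed
    define e where "e k = GSOR_iterate m \<omega> A b x0 k - x" for k
    have it: "GSOR_iterate m \<omega> A b x0 k \<in> carrier_vec n" for k
    proof (induction k)
      case (Suc k)
      have "dim_row (mat_inv P) = n"
        using Pi(1) by simp
      then show ?case
        by (intro carrier_vecI) (simp add: P_def T_def E_def)
    qed (use x0 in simp)
    have e: "e k \<in> carrier_vec n" for k
      using it x by (simp add: e_def)
    \<comment> \<open>Applying \<open>P\<close> removes its inverse from the iteration; subtracting
      the fixed point equation cancels \<open>b\<close>.\<close>
    have e_Suc: "P *\<^sub>v e (Suc k) = Q *\<^sub>v e k" for k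
    proof -
      let ?y = "GSOR_iterate m \<omega> A b x0 k"
      have y: "?y \<in> carrier_vec n" by (rule it)
      have PP: "P *\<^sub>v (mat_inv P *\<^sub>v z) = z" if "z \<in> carrier_vec n" for z
        using assoc_mult_mat_vec[OF P Pi(1) that] Pi(2) that by simp
      have "GSOR_iterate m \<omega> A b x0 (Suc k) = mat_inv P *\<^sub>v (Q *\<^sub>v ?y) + \<omega> \<cdot>\<^sub>v (mat_inv P *\<^sub>v b)"
        using assoc_mult_mat_vec[OF Pi(1) Q y] by (simp add: P_def Q_def T_def E_def F_def)
      moreover have "P *\<^sub>v (mat_inv P *\<^sub>v (Q *\<^sub>v ?y) + \<omega> \<cdot>\<^sub>v (mat_inv P *\<^sub>v b)) = Q *\<^sub>v ?y + \<omega> \<cdot>\<^sub>v b"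
        using Pi(1) P Q y b
        by (simp add: mult_add_distrib_mat_vec[OF P] mult_mat_vec[OF P] PP del: assoc_mult_mat_vec)
      ultimately have "P *\<^sub>v GSOR_iterate m \<omega> A b x0 (Suc k) = Q *\<^sub>v ?y + \<omega> \<cdot>\<^sub>v b"
        by (simp only:)
      then have "P *\<^sub>v e (Suc k) = (Q *\<^sub>v ?y + \<omega> \<cdot>\<^sub>v b) - (Q *\<^sub>v x + \<omega> \<cdot>\<^sub>v b)"
        unfolding e_def mult_minus_distrib_mat_vec[OF P it x] fixpoint by simp
      also have "\<dots> = Q *\<^sub>v ?y - Q *\<^sub>v x"
        using Q y x b by (intro eq_vecI) (simp_all del: index_mult_mat_vec)
      also have "\<dots> = Q *\<^sub>v e k"
        unfolding e_def mult_minus_distrib_mat_vec[OF Q it x] ..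
      finally show ?thesis .
    qed
    obtain q where q: "q < n" "\<And>i. i < n \<Longrightarrow> \<bar>e 0 $ i\<bar> / w $ i \<le> \<bar>e 0 $ q\<bar> / w $ q"
      using ex_max_index[OF n, of "\<lambda>i. \<bar>e 0 $ i\<bar> / w $ i"] by blast
    define c where "c = \<bar>e 0 $ q\<bar> / w $ q"
    have decay: "\<bar>e k $ i\<bar> \<le> \<theta> ^ k * c * w $ i" if "i < n" for k i
      using that
    proof (induction k arbitrary: i)
      case 0
      then show ?case
        using q(2)[of i] w(2)[of i] by (simp add: c_def[symmetric] pos_divide_le_eq)
    next
      case (Suc k)
      from step[OF e e e_Suc Suc.IH Suc.prems] show ?case
        by (simp add: mult.assoc)
    qed
    have "(\<lambda>k. GSOR_iterate m \<omega> A b x0 k $ i) \<longlonglongrightarrow> x $ i" if i: "i < n" for i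
    proof -
      have "(\<lambda>k. \<theta> ^ k * c * w $ i) \<longlonglongrightarrow> 0"
        using theta by (intro tendsto_mult_left_zero LIMSEQ_power_zero) auto
      then have "(\<lambda>k. e k $ i) \<longlonglongrightarrow> 0"
        by (rule tendsto_0_le[where K = 1])
          (auto intro!: always_eventually order_trans[OF decay[OF i] abs_ge_self])
      moreover have "e k $ i = GSOR_iterate m \<omega> A b x0 k $ i - x $ i" for k
        using x i by (simp add: e_def)
      ultimately show ?thesis
        by (simp add: LIM_zero_iff)
    qed
    with sol show ?thesis by blast
  qed
  then show ?thesis
    using P_inv A unfolding GSOR_converges_def by (simp add: P_def T_def E_def)
qed

end
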